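(* Let $P$ be a pushdown automaton, let $P_0$, $N$, $U_1$ and $P_1$ be obtained from it by the forward construction, and let $U_2$ be the set of transitions returned by the backward procedure (see context). Then $U_2$ consists of exactly the useless transitions in $P_1$, i.e. a transition of $P_1$ belongs to $U_2$ if and only if no run of $P_1$ from the initial configuration $(q_0,b_0)$ to a configuration whose state is the final state $q_f$ includes this transition.
   Context: **Pushdown automata.** Input symbols are disregarded. A pushdown automaton (pda) $P$ consists of a finite state set $Q$, a finite stack alphabet $\Gamma$, a finite set of transitions $q\stackrel{\sigma/\tau}{\rightarrow}r$ with $q,r\in Q$ and $\sigma,\tau\in\Gamma^*$ (zero or more symbols may be popped/pushed), an initial state $q_0$ and a set $F\subseteq Q$ of final states; the initial stack is empty. A configuration is a pair of a state and a stack in $\Gamma^*$ (top of the stack at the left). A transition $q\stackrel{\sigma/\tau}{\rightarrow}r$ gives moves $(q,\sigma\rho)\rightarrow(r,\tau\rho)$ for all $\rho\in\Gamma^*$; a run is a sequence of zero or more moves, written $\rightarrow^*$. $\varepsilon$ is the empty string and $\sigma^R$ the reverse of $\sigma$. **The pda $P_0$.** Given $P$, add a fresh stack symbol $b_0$ to $\Gamma$ and let the initial stack be $b_0$ (initial configuration $(q_0,b_0)$). Add fresh states $q_e,q_f$ to $Q$ and transitions $q\stackrel{\varepsilon/\varepsilon}{\rightarrow}q_e$ for every $q\in F$, $q_e\stackrel{a/\varepsilon}{\rightarrow}q_e$ for every $a\in\Gamma\setminus\{b_0\}$, and $q_e\stackrel{b_0/\varepsilon}{\rightarrow}q_f$.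 Then change $F$ to $\{q_f\}$. From now on $Q,\Gamma$ refer to $P_0$. **The nfa $N$.** $N$ is a nondeterministic finite automaton under construction, with labels in $\Gamma\cup\{\varepsilon\}$ and initial state $m_0$. Its final states are elements of $Q$; its other states ($m_0$ and fresh intermediate states) are non-final. We write $x\stackrel{a_1\ldots a_k}{\leadsto}y$ for a path in $N$ from $x$ to $y$ whose consecutive labels are exactly $a_1,\dots,a_k\in\Gamma$ (no $\varepsilon$-transitions; $k\ge 0$), and $x\stackrel{a_1\ldots a_k}{\Rightarrow}y$ for such a path possibly intertwined with $\varepsilon$-transitions. **Forward procedure.** Initially $N$ consists of the single transition $m_0\stackrel{b_0}{\rightarrow}q_0$ ($m_0$ fresh, non-final; $q_0$ final), and $U_1$ contains all transitions of $P_0$. One run of the procedure does the following for each transition $\theta=q\stackrel{\sigma/\tau}{\rightarrow}r$ of $P_0$: 1. If $q$ is not a state of $N$, stop this iteration step. 2. Determine $S_{q,\sigma}$: $S_{q,\sigma}=\{q\}$ if $\sigma=\varepsilon$; if $\sigma=\sigma'a$ with $a\in\Gamma$, it is the set of states $n$ for which there is a path $n\stackrel{a}{\rightarrow}y\stackrel{\sigma'^R}{\Rightarrow}q$ in $N$. 3. If $S_{q,\sigma}=\emptyset$, stop this iteration step. 4. If $\theta\in U_1$, delete $\theta$ from $U_1$ and establish a path $\stackrel{\tau^R}{\leadsto}r$ in $N$; the state $r$ is final in $N$. 5. Let $y$ be the first state of the path $\stackrel{\tau^R}{\leadsto}r$. For each $x\in S_{q,\sigma}$, add the transition $x\stackrel{\varepsilon}{\rightarrow}y$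 to $N$ if not yet present. Establishing a path $\stackrel{a_1\ldots a_k}{\leadsto}z$ and returning its first state: if $k=0$, return $z$; otherwise, if there is a transition $n\stackrel{a_k}{\rightarrow}z$ in $N$ with $n$ non-final (there is at most one), establish a path $\stackrel{a_1\ldots a_{k-1}}{\leadsto}n$ and return its first state; otherwise add fresh non-final states $n_1,\dots,n_k$ and transitions $n_1\stackrel{a_1}{\rightarrow}n_2\cdots n_k\stackrel{a_k}{\rightarrow}z$ and return $n_1$. If $N$ changed during a run over all transitions of $P_0$, the procedure is run again over all transitions; otherwise it stops and returns $N$ and $U_1$. The pda $P_1$ is $P_0$ with the transitions in $U_1$ removed. The sets $S_{q,\sigma}$ of the last run (i.e. with respect to the returned $N$) are kept. **Backward procedure.** If $m_0\stackrel{\varepsilon}{\rightarrow}q_f$ is not a transition of $N$, all transitions of $P_1$ are reported as useless (returned as $U_2$). Otherwise, initially $U_2$ contains all transitions of $P_1$, $E=\{m_0\stackrel{\varepsilon}{\rightarrow}q_f\}$, $D=\emptyset$ ($E,D$ are sets of $\varepsilon$-transitions of $N$). While $E\setminus D\ne\emptyset$: 1. Pick $x\stackrel{\varepsilon}{\rightarrow}y\in E\setminus D$ and add it to $D$. 2. Find the path $y\stackrel{\tau^R}{\leadsto}r$ in $N$ with $r$ a final state of $N$ (exactly one such path exists). 3. For each transition $\theta=q\stackrel{\sigma/\tau}{\rightarrow}r$ in $P_1$ (any $q,\sigma$; these $\tau,r$): if $x\notin S_{q,\sigma}$, skip $\theta$; otherwise delete $\theta$ from $U_2$ (if present), and, if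 $\sigma=\sigma'a$ with $a\in\Gamma$, add to $E$ all $\varepsilon$-transitions that occur in any path $x\stackrel{a}{\rightarrow}z\stackrel{\sigma'^R}{\Rightarrow}q$ in $N$. At the end $U_2$ is returned. *)

theory Defs
  imports Main
begin

section \<open>Pushdown automata\<close>

text \<open>\<open>(q, \<sigma>, \<tau>, r)\<close> is the transition from \<open>q\<close> to \<open>r\<close> that pops \<open>\<sigma>\<close> and pushes \<open>\<tau>\<close>.
  Stacks and the strings \<open>\<sigma>\<close>, \<open>\<tau>\<close> have the top of the stack at the head of the list.\<close>

type_synonym ('q, 'g) transition = "'q \<times> 'g list \<times> 'g list \<times> 'q"

record ('q, 'g) pda =
  states :: "'q set"
  alphabet :: "'g set"
  transitions :: "('q, 'g) transition set"
  start :: 'q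
  start_stack :: "'g list"
  finals :: "'q set"

definition is_pda :: "('q, 'g) pda \<Rightarrow> bool" where
  "is_pda P \<longleftrightarrow>
     finite (states P) \<and> finite (alphabet P) \<and> finite (transitions P) \<and>
     transitions P \<subseteq>
       states P \<times> lists (alphabet P) \<times> lists (alphabet P) \<times> states P \<and>
     start P \<in> states P \<and> start_stack P = [] \<and> finals P \<subseteq> states P"

type_synonym ('q, 'g) config = "'q \<times> 'g list"

inductive move :: "('q, 'g) pda \<Rightarrow> ('q, 'g) transition \<Rightarrow> ('q, 'g) config \<Rightarrow> ('q, 'g) config \<Rightarrow> bool"
  for P where
  "(q, \<sigma>, \<tau>, r) \<in> transitions P \<Longrightarrow> \<rho> \<in> lists (alphabet P) \<Longrightarrow>
   move P (q, \<sigma>, \<tau>, r) (q, \<sigma> @ \<rho>) (r, \<tau> @ \<rho>)"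

text \<open>Runs carry the list of transitions used, since different transitions may induce the same
  move.\<close>

inductive run :: "('q, 'g) pda \<Rightarrow> ('q, 'g) config \<Rightarrow> ('q, 'g) transition list \<Rightarrow> ('q, 'g) config \<Rightarrow> bool"
  for P where
  run_Nil: "run P c [] c"
| run_Cons: "move P \<theta> c c' \<Longrightarrow> run P c' \<theta>s c'' \<Longrightarrow> run P c (\<theta> # \<theta>s) c''"

definition useless :: "('q, 'g) pda \<Rightarrow> ('q, 'g) transition \<Rightarrow> bool" where
  "useless P \<theta> \<longleftrightarrow>
     \<not> (\<exists>\<theta>s q \<gamma>. run P (start P, start_stack P) \<theta>s (q, \<gamma>) \<and> q \<in> finals P \<and> \<theta> \<in> set \<theta>s)"

definition remove_transitions ::
  "('q, 'g) transition set \<Rightarrow> ('q, 'g) pda \<Rightarrow> ('q, 'g) pda" where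
  "remove_transitions U P = P\<lparr>transitions := transitions P - U\<rparr>"


section \<open>The automaton with bottom marker\<close>

text \<open>\<open>Bottom\<close>, \<open>Emptying\<close> and \<open>Accepting\<close> are the fresh \<open>b\<^sub>0\<close>, \<open>q\<^sub>e\<close> and \<open>q\<^sub>f\<close>.\<close>

datatype 'g marked = Sym 'g | Bottom
datatype 'q extended = Orig 'q | Emptying | Accepting

definition with_bottom :: "('q, 'g) pda \<Rightarrow> ('q extended, 'g marked) pda" where
  "with_bottom P =
     \<lparr>states = Orig ` states P \<union> {Emptying, Accepting},
      alphabet = insert Bottom (Sym ` alphabet P),
      transitions =
        {(Orig q, map Sym \<sigma>, map Sym \<tau>, Orig r) | q \<sigma> \<tau> r. (q, \<sigma>, \<tau>, r) \<in> transitions P} \<union>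
        {(Orig q, [], [], Emptying) | q. q \<in> finals P} \<union>
        {(Emptying, [Sym a], [], Emptying) | a. a \<in> alphabet P} \<union>
        {(Emptying, [Bottom], [], Accepting)},
      start = Orig (start P),
      start_stack = [Bottom],
      finals = {Accepting}\<rparr>"


section \<open>The nondeterministic finite automaton\<close>

text \<open>The final states are the \<open>Final q\<close>, where \<open>q\<close> is a state of the pushdown automaton.
  \<open>M0\<close> is the initial state; the \<open>Inner i\<close> are the supply of fresh intermediate states.\<close>

datatype 'q nfa_state = is_final: Final 'q | M0 | Inner nat

text \<open>The label \<open>None\<close> stands for \<open>\<epsilon>\<close>.\<close>

type_synonym ('q, 'g) edge = "'q nfa_state \<times> 'g option \<times> 'q nfa_state"

record ('q, 'g) nfa =
  nodes :: "'q nfa_state set"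
  edges :: "('q, 'g) edge set"

fun path :: "('q, 'g) nfa \<Rightarrow> 'q nfa_state \<Rightarrow> ('q, 'g) edge list \<Rightarrow> 'q nfa_state \<Rightarrow> bool" where
  "path N x [] y \<longleftrightarrow> x = y \<and> x \<in> nodes N"
| "path N x ((u, l, v) # es) y \<longleftrightarrow> u = x \<and> (u, l, v) \<in> edges N \<and> path N v es y"

definition labels :: "('q, 'g) edge list \<Rightarrow> 'g option list" where
  "labels es = map (\<lambda>(u, l, v). l) es"

definition strict_path :: "('q, 'g) nfa \<Rightarrow> 'q nfa_state \<Rightarrow> 'g list \<Rightarrow> 'q nfa_state \<Rightarrow> bool" where
  "strict_path N x w y \<longleftrightarrow> (\<exists>es. path N x es y \<and> labels es = map Some w)"

definition eps_path ::
  "('q, 'g) nfa \<Rightarrow> 'q nfa_state \<Rightarrow> 'g list \<Rightarrow> ('q, 'g) edge list \<Rightarrow> 'q nfa_state \<Rightarrow> bool" where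
  "eps_path N x w es y \<longleftrightarrow> path N x es y \<and> List.map_filter id (labels es) = w"

text \<open>For \<open>\<sigma> = \<sigma>'a\<close>, the paths from \<open>x\<close> to \<open>q\<close> that start with an \<open>a\<close>-transition and
  continue with \<open>\<sigma>'\<^sup>R\<close>, possibly intertwined with \<open>\<epsilon>\<close>-transitions.\<close>

definition pop_path ::
  "('q, 'g) nfa \<Rightarrow> 'q nfa_state \<Rightarrow> 'g list \<Rightarrow> ('q, 'g) edge list \<Rightarrow> 'q \<Rightarrow> bool" where
  "pop_path N x \<sigma> es q \<longleftrightarrow>
     (\<exists>\<sigma>' a z es'. \<sigma> = \<sigma>' @ [a] \<and> es = (x, Some a, z) # es' \<and> (x, Some a, z) \<in> edges N \<and>
        eps_path N z (rev \<sigma>') es' (Final q))"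

definition pop_sources :: "('q, 'g) nfa \<Rightarrow> 'q \<Rightarrow> 'g list \<Rightarrow> 'q nfa_state set" where
  "pop_sources N q \<sigma> = (if \<sigma> = [] then {Final q} else {x. \<exists>es. pop_path N x \<sigma> es q})"


section \<open>Forward procedure\<close>

text \<open>\<open>establish N w z N' y\<close>: establishing a path labelled \<open>w\<close> that ends in \<open>z\<close> turns \<open>N\<close> into
  \<open>N'\<close> and returns the first state \<open>y\<close>. The end state is made a state of the automaton.\<close>

inductive establish ::
  "('q, 'g) nfa \<Rightarrow> 'g list \<Rightarrow> 'q nfa_state \<Rightarrow> ('q, 'g) nfa \<Rightarrow> 'q nfa_state \<Rightarrow> bool" where
  establish_Nil: "establish N [] z (N\<lparr>nodes := insert z (nodes N)\<rparr>) z"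
| establish_reuse:
    "(n, Some a, z) \<in> edges N \<Longrightarrow> \<not> is_final n \<Longrightarrow> establish N w n N' y \<Longrightarrow>
     establish N (w @ [a]) z N' y"
| establish_fresh:
    "w \<noteq> [] \<Longrightarrow> \<not> (\<exists>n. (n, Some (last w), z) \<in> edges N \<and> \<not> is_final n) \<Longrightarrow>
     length ns = length w \<Longrightarrow> distinct ns \<Longrightarrow> \<forall>n\<in>set ns. \<not> is_final n \<and> n \<notin> nodes N \<Longrightarrow>
     establish N w z
       \<lparr>nodes = insert z (nodes N \<union> set ns),
        edges = edges N \<union> set (zip ns (zip (map Some w) (tl ns @ [z])))\<rparr>
       (hd ns)"

definition add_eps_edges ::
  "'q nfa_state set \<Rightarrow> 'q nfa_state \<Rightarrow> ('q, 'g) nfa \<Rightarrow> ('q, 'g) nfa" where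
  "add_eps_edges S y N = N\<lparr>edges := edges N \<union> {(x, None, y) | x. x \<in> S}\<rparr>"

text \<open>One iteration step, on the automaton under construction and the set \<open>U\<^sub>1\<close>.\<close>

inductive forward_step ::
  "('q, 'g) transition \<Rightarrow> ('q, 'g) nfa \<times> ('q, 'g) transition set \<Rightarrow>
   ('q, 'g) nfa \<times> ('q, 'g) transition set \<Rightarrow> bool" where
  step_no_state:
    "Final q \<notin> nodes N \<Longrightarrow> forward_step (q, \<sigma>, \<tau>, r) (N, U) (N, U)"
| step_no_source:
    "Final q \<in> nodes N \<Longrightarrow> pop_sources N q \<sigma> = {} \<Longrightarrow>
     forward_step (q, \<sigma>, \<tau>, r) (N, U) (N, U)"
| step_first:
    "Final q \<in> nodes N \<Longrightarrow> pop_sources N q \<sigma> \<noteq> {} \<Longrightarrow> (q, \<sigma>, \<tau>, r) \<in> U \<Longrightarrow>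
     establish N (rev \<tau>) (Final r) N' y \<Longrightarrow>
     forward_step (q, \<sigma>, \<tau>, r) (N, U)
       (add_eps_edges (pop_sources N q \<sigma>) y N', U - {(q, \<sigma>, \<tau>, r)})"
| step_again:
    "Final q \<in> nodes N \<Longrightarrow> pop_sources N q \<sigma> \<noteq> {} \<Longrightarrow> (q, \<sigma>, \<tau>, r) \<notin> U \<Longrightarrow>
     strict_path N y (rev \<tau>) (Final r) \<Longrightarrow>
     forward_step (q, \<sigma>, \<tau>, r) (N, U) (add_eps_edges (pop_sources N q \<sigma>) y N, U)"

inductive forward_steps ::
  "('q, 'g) transition list \<Rightarrow> ('q, 'g) nfa \<times> ('q, 'g) transition set \<Rightarrow>
   ('q, 'g) nfa \<times> ('q, 'g) transition set \<Rightarrow> bool" where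
  steps_Nil: "forward_steps [] s s"
| steps_Cons: "forward_step \<theta> s s' \<Longrightarrow> forward_steps \<theta>s s' s'' \<Longrightarrow> forward_steps (\<theta> # \<theta>s) s s''"

text \<open>The order in which a pass visits the transitions is arbitrary, and may differ from pass to
  pass.\<close>

definition forward_pass ::
  "('q, 'g) pda \<Rightarrow> ('q, 'g) nfa \<times> ('q, 'g) transition set \<Rightarrow>
   ('q, 'g) nfa \<times> ('q, 'g) transition set \<Rightarrow> bool" where
  "forward_pass P s s' \<longleftrightarrow>
     (\<exists>\<theta>s. distinct \<theta>s \<and> set \<theta>s = transitions P \<and> forward_steps \<theta>s s s')"

inductive forward_loop ::
  "('q, 'g) pda \<Rightarrow> ('q, 'g) nfa \<times> ('q, 'g) transition set \<Rightarrow>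
   ('q, 'g) nfa \<times> ('q, 'g) transition set \<Rightarrow> bool"
  for P where
  loop_stop: "forward_pass P (N, U) (N, U') \<Longrightarrow> forward_loop P (N, U) (N, U')"
| loop_again:
    "forward_pass P (N, U) (N', U') \<Longrightarrow> N' \<noteq> N \<Longrightarrow> forward_loop P (N', U') s \<Longrightarrow>
     forward_loop P (N, U) s"

definition forward ::
  "'g \<Rightarrow> ('q, 'g) pda \<Rightarrow> ('q, 'g) nfa \<Rightarrow> ('q, 'g) transition set \<Rightarrow> bool" where
  "forward b\<^sub>0 P N U\<^sub>1 \<longleftrightarrow>
     forward_loop P
       (\<lparr>nodes = {M0, Final (start P)}, edges = {(M0, Some b\<^sub>0, Final (start P))}\<rparr>, transitions P)
       (N, U\<^sub>1)"


section \<open>Backward procedure\<close>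

text \<open>One iteration of the while loop, on the triple \<open>(U\<^sub>2, E, D)\<close>.\<close>

inductive backward_step ::
  "('q, 'g) pda \<Rightarrow> ('q, 'g) nfa \<Rightarrow>
   ('q, 'g) transition set \<times> ('q, 'g) edge set \<times> ('q, 'g) edge set \<Rightarrow>
   ('q, 'g) transition set \<times> ('q, 'g) edge set \<times> ('q, 'g) edge set \<Rightarrow> bool"
  for P N where
  "(x, None, y) \<in> E - D \<Longrightarrow>
   strict_path N y (rev \<tau>) (Final r) \<Longrightarrow>
   backward_step P N (U, E, D)
     (U - {(q, \<sigma>, \<tau>, r) | q \<sigma>. (q, \<sigma>, \<tau>, r) \<in> transitions P \<and> x \<in> pop_sources N q \<sigma>},
      E \<union> {(u, None, v) | u v q \<sigma> es.
             (q, \<sigma>, \<tau>, r) \<in> transitions P \<and> x \<in> pop_sources N q \<sigma> \<and>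
             pop_path N x \<sigma> es q \<and> (u, None, v) \<in> set es},
      insert (x, None, y) D)"

definition backward ::
  "'q \<Rightarrow> ('q, 'g) pda \<Rightarrow> ('q, 'g) nfa \<Rightarrow> ('q, 'g) transition set \<Rightarrow> bool" where
  "backward q\<^sub>f P N U\<^sub>2 \<longleftrightarrow>
     (if (M0, None, Final q\<^sub>f) \<notin> edges N then U\<^sub>2 = transitions P
      else \<exists>E D. (backward_step P N)\<^sup>*\<^sup>* (transitions P, {(M0, None, Final q\<^sub>f)}, {}) (U\<^sub>2, E, D) \<and>
                 E - D = {})"

end

theory Submission
  imports Defs
begin

text \<open>In \<open>N\<close> every state has a unique strict path to a final state, say to \<open>r\<close> with word
  \<open>\<tau>\<^sup>R\<close>, and thus stands for the configurations \<open>(r, \<tau>\<rho>)\<close>. An \<open>\<epsilon>\<close>-edge is then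
  a run between such configurations, valid for all \<open>\<rho>\<close>; hence every path \<open>v \<Rightarrow> q\<close> is one too, and
  the edges collected in \<open>E\<close> lie on accepting runs. Conversely, \<open>N\<close> is saturated, so a path for a
  configuration can be followed along an accepting run. The only path to \<open>q\<^sub>f\<close> is the single edge
  \<open>m\<^sub>0 \<rightarrow> q\<^sub>f\<close>, which is in \<open>E\<close>. Going back along the run from there, all \<open>\<epsilon>\<close>-edges of the paths
  belong to \<open>E\<close>, so all transitions of the run have been deleted from \<open>U\<^sub>2\<close>.\<close>

section \<open>Runs and paths\<close>

lemma run_append: "run P c \<theta>s c' \<Longrightarrow> run P c' \<theta>s' c'' \<Longrightarrow> run P c (\<theta>s @ \<theta>s') c''"
  by (induction rule: run.induct) (auto intro: run.intros)

text \<open>Needed because \<open>U\<^sub>1\<close> only shrinks: runs found early in the forward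
  procedure remain available later.\<close>

lemma run_remove_transitions_antimono:
  "run (remove_transitions U P) c \<theta>s c' \<Longrightarrow> U' \<subseteq> U \<Longrightarrow> run (remove_transitions U' P) c \<theta>s c'"
proof (induction rule: run.induct)
  case (run_Cons \<theta> c c' \<theta>s c'')
  then have "move (remove_transitions U' P) \<theta> c c'"
    by (auto simp: remove_transitions_def elim!: move.cases intro!: move.intros)
  with run_Cons show ?case
    by (auto intro: run.intros)
qed (rule run_Nil)

definition word :: "('q, 'g) edge list \<Rightarrow> 'g list" where
  "word es = List.map_filter id (labels es)"

lemma word_simps [simp]:
  "word [] = []"
  "word ((x, None, y) # es) = word es"
  "word ((x, Some a, y) # es) = a # word es"
  "word (es @ es') = word es @ word es'"
  by (simp_all add: word_def labels_def List.map_filter_def)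

lemma eps_path_iff: "eps_path N x w es y \<longleftrightarrow> path N x es y \<and> word es = w"
  by (simp add: eps_path_def word_def)

lemma labels_simps [simp]:
  "labels [] = []"
  "labels ((x, l, y) # es) = l # labels es"
  by (simp_all add: labels_def)

lemma word_strict: "labels es = map Some w \<Longrightarrow> word es = w"
  by (simp add: word_def List.map_filter_def comp_def)

lemma path_append: "path N x es y \<Longrightarrow> path N y es' z \<Longrightarrow> path N x (es @ es') z"
  by (induction N x es y rule: path.induct) auto

lemma path_end: "path N x es y \<Longrightarrow> y \<in> nodes N"
  by (induction N x es y rule: path.induct) auto

lemma strict_path_Nil [simp]: "strict_path N x [] y \<longleftrightarrow> x = y \<and> x \<in> nodes N"
  by (simp add: strict_path_def labels_def)

lemma strict_path_Cons:
  "strict_path N x (a # w) y \<longleftrightarrow> (\<exists>z. (x, Some a, z) \<in> edges N \<and> strict_path N z w y)"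
proof
  assume "strict_path N x (a # w) y"
  then obtain es where es: "path N x es y" "labels es = Some a # map Some w"
    by (auto simp: strict_path_def)
  then obtain u v es' where "es = (u, Some a, v) # es'"
    by (cases es) auto
  with es show "\<exists>z. (x, Some a, z) \<in> edges N \<and> strict_path N z w y"
    by (auto simp: strict_path_def)
next
  assume "\<exists>z. (x, Some a, z) \<in> edges N \<and> strict_path N z w y"
  then obtain z es where "(x, Some a, z) \<in> edges N" "path N z es y" "labels es = map Some w"
    by (auto simp: strict_path_def)
  then show "strict_path N x (a # w) y"
    unfolding strict_path_def by (intro exI[of _ "(x, Some a, z) # es"]) auto
qed

lemma strict_path_snoc:
  "strict_path N x w y \<Longrightarrow> (y, Some a, z) \<in> edges N \<Longrightarrow> z \<in> nodes N \<Longrightarrow> strict_path N x (w @ [a]) z"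
  by (induction w arbitrary: x) (auto simp: strict_path_Cons)

section \<open>Monotone growth of the automaton\<close>

definition subnfa :: "('q, 'g) nfa \<Rightarrow> ('q, 'g) nfa \<Rightarrow> bool" where
  "subnfa N N' \<longleftrightarrow> nodes N \<subseteq> nodes N' \<and> edges N \<subseteq> edges N'"

lemma subnfa_refl [simp]: "subnfa N N"
  and subnfa_trans: "subnfa N N' \<Longrightarrow> subnfa N' N'' \<Longrightarrow> subnfa N N''"
  and subnfa_antisym: "subnfa N N' \<Longrightarrow> subnfa N' N \<Longrightarrow> N = N'"
  by (auto simp: subnfa_def)

lemma subnfa_add_eps_edges: "subnfa N (add_eps_edges S y N)"
  by (auto simp: subnfa_def add_eps_edges_def)

lemma path_mono: "path N x es y \<Longrightarrow> subnfa N N' \<Longrightarrow> path N' x es y"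
  by (induction N x es y rule: path.induct) (auto simp: subnfa_def)

lemma strict_path_mono: "strict_path N x w y \<Longrightarrow> subnfa N N' \<Longrightarrow> strict_path N' x w y"
  by (auto simp: strict_path_def intro: path_mono)

lemma pop_path_imp_path: "pop_path N x \<sigma> es q \<Longrightarrow> path N x es (Final q) \<and> word es = rev \<sigma>"
  by (auto simp: pop_path_def eps_path_iff)

lemma pop_sources_path:
  assumes "x \<in> pop_sources N q \<sigma>" "\<sigma> = [] \<Longrightarrow> x \<in> nodes N"
  obtains es where "path N x es (Final q)" "word es = rev \<sigma>"
proof (cases "\<sigma> = []")
  case True
  with assms have "path N x [] (Final q)" "word [] = rev \<sigma>"
    by (auto simp: pop_sources_def)
  then show ?thesis by (rule that)
next
  case False
  with assms obtain es where "pop_path N x \<sigma> es q"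
    by (auto simp: pop_sources_def)
  from pop_path_imp_path[OF this] show ?thesis
    by (auto intro: that)
qed

lemma establish_subnfa: "establish N w z N' y \<Longrightarrow> subnfa N N'"
  by (induction rule: establish.induct) (auto simp: subnfa_def)

lemma forward_step_subnfa: "forward_step \<theta> s s' \<Longrightarrow> subnfa (fst s) (fst s')"
  by (induction rule: forward_step.induct)
    (auto intro: subnfa_add_eps_edges subnfa_trans dest!: establish_subnfa)

lemma forward_steps_subnfa: "forward_steps \<theta>s s s' \<Longrightarrow> subnfa (fst s) (fst s')"
  by (induction rule: forward_steps.induct) (auto intro: subnfa_trans forward_step_subnfa)

text \<open>Steps only add nodes and edges, so a pass that ends with its initial automaton never
  left it. Only the automaton is compared, hence the existentially quantified \<open>U\<close> and
  \<open>U'\<close>.\<close>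

lemma forward_steps_stationary:
  "forward_steps \<theta>s s s' \<Longrightarrow> fst s' = fst s \<Longrightarrow> \<theta> \<in> set \<theta>s \<Longrightarrow>
   \<exists>U U'. forward_step \<theta> (fst s, U) (fst s, U')"
proof (induction rule: forward_steps.induct)
  case (steps_Cons \<theta>' s s' \<theta>s s'')
  from steps_Cons.hyps have "subnfa (fst s) (fst s')" "subnfa (fst s') (fst s'')"
    by (auto dest: forward_step_subnfa forward_steps_subnfa)
  with steps_Cons.prems have eq: "fst s' = fst s"
    by (auto intro: subnfa_antisym)
  show ?case
  proof (cases "\<theta> = \<theta>'")
    case True
    with steps_Cons.hyps(1) eq show ?thesis by (metis prod.collapse)
  next
    case False
    with steps_Cons eq show ?thesis by auto
  qed
qed simp

text \<open>Isolates what the bottom marker contributes, free of the concrete datatypes. Its main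
  use is \<open>path_to_accepting\<close>: the whole initial stack is gone when
  \<open>q\<^sub>f\<close> is entered, so only one path leads there.\<close>

locale marked_pda =
  fixes P :: "('q, 'g) pda" and b\<^sub>0 :: 'g and q\<^sub>f :: 'q
  assumes transition_words:
      "(q, \<sigma>, \<tau>, r) \<in> transitions P \<Longrightarrow> set \<sigma> \<subseteq> alphabet P \<and> set \<tau> \<subseteq> alphabet P - {b\<^sub>0}"
    and bottom_in_alphabet: "b\<^sub>0 \<in> alphabet P"
    and accepting_transition: "(q, \<sigma>, \<tau>, q\<^sub>f) \<in> transitions P \<Longrightarrow> \<sigma> = [b\<^sub>0] \<and> \<tau> = []"
    and start_stack: "start_stack P = [b\<^sub>0]"
    and finals: "finals P = {q\<^sub>f}"
    and start_not_accepting: "start P \<noteq> q\<^sub>f"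
begin

section \<open>Invariants of the forward procedure\<close>

text \<open>The labelled edges form a forest directed towards the final states, which is why a node
  can stand for a configuration. The clauses about \<open>M0\<close>, \<open>b\<^sub>0\<close> and
  \<open>q\<^sub>f\<close> serve to show that the only path from \<open>M0\<close> to
  \<open>q\<^sub>f\<close> is a single edge.\<close>

definition well_formed :: "('q, 'g) nfa \<Rightarrow> bool" where
  "well_formed N \<longleftrightarrow>
     (\<forall>x l y. (x, l, y) \<in> edges N \<longrightarrow> x \<in> nodes N \<and> y \<in> nodes N \<and> y \<noteq> M0) \<and>
     (\<forall>x a y. (x, Some a, y) \<in> edges N \<longrightarrow>
        \<not> is_final x \<and> a \<in> alphabet P \<and> (a = b\<^sub>0 \<longrightarrow> x = M0) \<and> y \<noteq> Final q\<^sub>f) \<and>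
     (\<forall>x. (x, None, Final q\<^sub>f) \<in> edges N \<longrightarrow> x = M0) \<and>
     (\<forall>x a y a' y'. (x, Some a, y) \<in> edges N \<longrightarrow> (x, Some a', y') \<in> edges N \<longrightarrow> a = a' \<and> y = y') \<and>
     (\<forall>x \<in> nodes N. \<exists>w q. strict_path N x w (Final q)) \<and>
     (M0, Some b\<^sub>0, Final (start P)) \<in> edges N"

lemma well_formedD:
  assumes "well_formed N"
  shows "(x, l, y) \<in> edges N \<Longrightarrow> x \<in> nodes N \<and> y \<in> nodes N \<and> y \<noteq> M0"
    and "(x, Some a, y) \<in> edges N \<Longrightarrow>
      \<not> is_final x \<and> a \<in> alphabet P \<and> (a = b\<^sub>0 \<longrightarrow> x = M0) \<and> y \<noteq> Final q\<^sub>f"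
    and "(x, None, Final q\<^sub>f) \<in> edges N \<Longrightarrow> x = M0"
    and "(x, Some a, y) \<in> edges N \<Longrightarrow> (x, Some a', y') \<in> edges N \<Longrightarrow> a = a' \<and> y = y'"
    and "x \<in> nodes N \<Longrightarrow> \<exists>w q. strict_path N x w (Final q)"
    and "(M0, Some b\<^sub>0, Final (start P)) \<in> edges N"
  using assms unfolding well_formed_def by blast+

text \<open>Labelled edges are deterministic and none leaves a final state, so two strict paths can
  neither branch nor stop at different points.\<close>

lemma strict_path_unique:
  assumes "well_formed N"
  shows "strict_path N x w (Final q) \<Longrightarrow> strict_path N x w' (Final q') \<Longrightarrow> w = w' \<and> q = q'"
proof (induction w arbitrary: x w')
  case Nil
  then show ?case
    using well_formedD(2)[OF assms] by (cases w') (fastforce simp: strict_path_Cons)+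
next
  case (Cons a w)
  show ?case
  proof (cases w')
    case Nil
    with Cons.prems show ?thesis
      using well_formedD(2)[OF assms] by (fastforce simp: strict_path_Cons)
  next
    case (Cons a' w'')
    with Cons.prems Cons.IH show ?thesis
      using well_formedD(4)[OF assms] by (metis strict_path_Cons)
  qed
qed

text \<open>The only labelled edge leaving \<open>M0\<close> carries \<open>b\<^sub>0\<close>. As no
  pushed string contains that symbol, \<open>M0\<close> is never the start of an established
  path.\<close>

lemma strict_path_from_M0:
  assumes "well_formed N" "strict_path N M0 w (Final q)"
  shows "b\<^sub>0 \<in> set w"
  using assms(2) well_formedD(4)[OF assms(1) well_formedD(6)[OF assms(1)]]
  by (cases w) (auto simp: strict_path_Cons)

lemma word_in_alphabet:
  assumes "well_formed N" "path N x es y"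
  shows "set (word es) \<subseteq> alphabet P"
  using assms(2)
proof (induction es arbitrary: x)
  case (Cons e es)
  then show ?case
    using well_formedD(2)[OF assms(1)] by (cases e; cases "fst (snd e)") auto
qed simp

text \<open>The reversals arise because paths read the stack bottom up. \<open>U\<close> holds the
  transitions not yet applied; removing them makes the runs use only transitions that end up in
  \<open>P\<^sub>1\<close>.\<close>

definition sound :: "('q, 'g) nfa \<Rightarrow> ('q, 'g) transition set \<Rightarrow> bool" where
  "sound N U \<longleftrightarrow>
     (\<forall>x y. (x, None, y) \<in> edges N \<longrightarrow>
        (\<exists>w p w' r. strict_path N x w (Final p) \<and> strict_path N y w' (Final r) \<and>
           (\<forall>\<rho> \<in> lists (alphabet P). \<exists>\<theta>s.
              run (remove_transitions U P) (p, rev w @ \<rho>) \<theta>s (r, rev w' @ \<rho>))))"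

lemma sound_antimono: "sound N U \<Longrightarrow> U' \<subseteq> U \<Longrightarrow> sound N U'"
  unfolding sound_def by (meson run_remove_transitions_antimono)

text \<open>An \<epsilon>-edge contributes the run given by soundness. A labelled edge contributes
  no move: its symbol passes from \<open>w\<close> to the lower part \<open>\<rho>\<close> of the
  stack, so \<open>\<rho>\<close> has to vary in the induction.\<close>

lemma path_imp_run:
  assumes wf: "well_formed N" and "sound N U"
  shows "path N x es (Final q) \<Longrightarrow> strict_path N x w (Final p) \<Longrightarrow> \<rho> \<in> lists (alphabet P) \<Longrightarrow>
    \<exists>\<theta>s. run (remove_transitions U P) (p, rev w @ \<rho>) \<theta>s (q, rev (word es) @ \<rho>)"
proof (induction es arbitrary: x w p \<rho>)
  case Nil
  then have "strict_path N x [] (Final q)" by auto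
  with Nil strict_path_unique[OF wf] have "w = [] \<and> p = q" by blast
  then show ?case by (auto intro: run_Nil)
next
  case (Cons e es)
  obtain l y where e: "e = (x, l, y)" "(x, l, y) \<in> edges N" "path N y es (Final q)"
    using Cons.prems(1) by (cases e) auto
  show ?case
  proof (cases l)
    case None
    with e \<open>sound N U\<close> obtain v p' v' r where
      *: "strict_path N x v (Final p')" "strict_path N y v' (Final r)"
        "\<exists>\<theta>s. run (remove_transitions U P) (p', rev v @ \<rho>) \<theta>s (r, rev v' @ \<rho>)"
      using Cons.prems(3) unfolding sound_def by meson
    with strict_path_unique[OF wf Cons.prems(2)] have "v = w" "p' = p" by auto
    with * Cons.IH[OF e(3) *(2) Cons.prems(3)] None e(1) show ?thesis
      by (auto dest: run_append)
  next
    case (Some a)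
    with e(2) well_formedD(2)[OF wf] have "\<not> is_final x" "a \<in> alphabet P" by auto
    moreover from this Cons.prems(2) obtain a' w' where w: "w = a' # w'"
      by (cases w) auto
    moreover from this Cons.prems(2) Some e(2) well_formedD(4)[OF wf]
    have "a' = a" "strict_path N y w' (Final p)"
      by (auto simp: strict_path_Cons) blast+
    moreover note Cons.IH[OF e(3), of w' p "a # \<rho>"] Cons.prems(3)
    ultimately show ?thesis
      using e(1) Some by auto
  qed
qed

section \<open>Well-formedness under added nodes and paths\<close>

lemma well_formed_insert_node:
  assumes "well_formed N" "is_final z \<or> z \<in> nodes N"
  shows "well_formed (N\<lparr>nodes := insert z (nodes N)\<rparr>)" (is "well_formed ?N")
proof -
  have sub: "subnfa N ?N" by (auto simp: subnfa_def)
  have "\<exists>w q. strict_path ?N x w (Final q)" if "x \<in> nodes ?N" for x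
  proof (cases "x \<in> nodes N")
    case True
    then show ?thesis using well_formedD(5)[OF assms(1)] strict_path_mono[OF _ sub] by blast
  next
    case False
    with that assms(2) have "is_final x" "x = z" by auto
    then have "strict_path ?N x [] (Final (un_Final x))" by (cases x) auto
    then show ?thesis by blast
  qed
  then show ?thesis
    using assms(1) unfolding well_formed_def by simp
qed

text \<open>A fresh \<open>n\<close> is the source of no edge, so determinism survives, and its
  strict path continues with that of \<open>z\<close>.\<close>

lemma well_formed_insert_edge:
  assumes wf: "well_formed N" and n: "n \<notin> nodes N" "\<not> is_final n" and a: "a \<in> alphabet P - {b\<^sub>0}"
    and z: "z \<in> nodes N" "z \<noteq> M0" "z \<noteq> Final q\<^sub>f"
  shows "well_formed \<lparr>nodes = insert n (nodes N), edges = insert (n, Some a, z) (edges N)\<rparr>"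
    (is "well_formed ?N")
proof -
  have sub: "subnfa N ?N" by (auto simp: subnfa_def)
  have old: "\<exists>w q. strict_path ?N x w (Final q)" if "x \<in> nodes N" for x
    using that well_formedD(5)[OF wf] strict_path_mono[OF _ sub] by blast
  from old[OF z(1)] have "\<exists>w q. strict_path ?N n w (Final q)"
    by (metis strict_path_Cons insertI1 nfa.select_convs(2))
  with old have "\<forall>x \<in> nodes ?N. \<exists>w q. strict_path ?N x w (Final q)" by auto
  moreover have "(n, l, y) \<notin> edges N" for l y
    using n(1) well_formedD(1)[OF wf] by blast
  ultimately show ?thesis
    using wf n a z unfolding well_formed_def by (auto; blast)
qed

text \<open>Names the edge set in \<open>establish_fresh\<close>, to give it the recursion
  \<open>chain_simps\<close>.\<close>

definition chain ::
  "'q nfa_state list \<Rightarrow> 'g list \<Rightarrow> 'q nfa_state \<Rightarrow> ('q, 'g) edge set" where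
  "chain ns w z = set (zip ns (zip (map Some w) (tl ns @ [z])))"

lemma chain_simps:
  "chain [] [] z = {}"
  "chain (n # ns) (a # w) z = insert (n, Some a, hd (ns @ [z])) (chain ns w z)"
  by (auto simp: chain_def) (cases ns; auto)+

text \<open>The chain is built from its end \<open>z\<close> backwards, each node being attached to
  one already present. Writing \<open>hd (ns @ [z])\<close> makes \<open>z\<close> the first node of
  an empty chain.\<close>

lemma well_formed_chain:
  assumes "length ns = length w" "well_formed N" "z \<in> nodes N" "z \<noteq> M0" "z = Final q\<^sub>f \<Longrightarrow> w = []"
    "distinct ns" "\<forall>n\<in>set ns. \<not> is_final n \<and> n \<notin> nodes N" "set w \<subseteq> alphabet P - {b\<^sub>0}"
  shows "let N' = \<lparr>nodes = nodes N \<union> set ns, edges = edges N \<union> chain ns w z\<rparr> in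
    well_formed N' \<and> strict_path N' (hd (ns @ [z])) w z"
  using assms
proof (induction ns w rule: list_induct2)
  case Nil
  then show ?case by (cases N) (simp add: chain_simps)
next
  case (Cons n ns a w)
  define N1 where "N1 = \<lparr>nodes = nodes N \<union> set ns, edges = edges N \<union> chain ns w z\<rparr>"
  define N2 where "N2 = \<lparr>nodes = insert n (nodes N1), edges = insert (n, Some a, hd (ns @ [z])) (edges N1)\<rparr>"
  have N1: "well_formed N1" "strict_path N1 (hd (ns @ [z])) w z"
    using Cons by (auto simp: N1_def Let_def)
  \<comment> \<open>Hence the fresh nodes differ from \<open>M0\<close>, which must not be the
    target of an edge.\<close>
  have "M0 \<in> nodes N"
    using well_formedD(1)[OF \<open>well_formed N\<close>] well_formedD(6)[OF \<open>well_formed N\<close>] by blast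
  with Cons.prems have "hd (ns @ [z]) \<in> nodes N1" "hd (ns @ [z]) \<noteq> M0" "hd (ns @ [z]) \<noteq> Final q\<^sub>f"
    by (cases ns; auto simp: N1_def)+
  with Cons.prems have "well_formed N2"
    unfolding N2_def by (intro well_formed_insert_edge N1) (auto simp: N1_def)
  moreover have "strict_path N2 (hd (ns @ [z])) w z"
    by (rule strict_path_mono[OF N1(2)]) (auto simp: N2_def subnfa_def)
  then have "strict_path N2 n (a # w) z"
    by (auto simp: strict_path_Cons N2_def)
  moreover have "N2 = \<lparr>nodes = nodes N \<union> set (n # ns), edges = edges N \<union> chain (n # ns) (a # w) z\<rparr>"
    by (simp add: N1_def N2_def chain_simps)
  ultimately show ?case by (simp add: Let_def)
qed

lemma chain_no_eps: "(x, None, y) \<notin> chain ns w z"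
  by (auto simp: chain_def set_zip)

text \<open>Reuse continues at a node other than \<open>M0\<close>, since its edge is not labelled
  \<open>b\<^sub>0\<close>. No \<epsilon>-edge is added, so soundness can be inherited. The
  condition on \<open>q\<^sub>f\<close> will hold because transitions into \<open>q\<^sub>f\<close>
  push nothing.\<close>

lemma establish_invariant:
  assumes "establish N w z N' y" "well_formed N" "set w \<subseteq> alphabet P - {b\<^sub>0}"
    "is_final z \<or> z \<in> nodes N" "z \<noteq> M0" "z = Final q\<^sub>f \<Longrightarrow> w = []"
  shows "well_formed N' \<and> strict_path N' y w z \<and>
    (\<forall>u v. (u, None, v) \<in> edges N' \<longrightarrow> (u, None, v) \<in> edges N)"
  using assms
proof (induction rule: establish.induct)
  case (establish_Nil N z)
  then show ?case by (simp add: well_formed_insert_node)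
next
  case (establish_reuse n a z N w N' y)
  note wf = \<open>well_formed N\<close>
  have "n \<noteq> M0"
    using well_formedD(4)[OF wf well_formedD(6)[OF wf], of a z] establish_reuse.hyps(1)
      establish_reuse.prems(2) by auto
  moreover have "n \<in> nodes N" "z \<in> nodes N"
    using well_formedD(1)[OF wf establish_reuse.hyps(1)] by auto
  moreover have "n \<noteq> Final q\<^sub>f" "set w \<subseteq> alphabet P - {b\<^sub>0}"
    using establish_reuse by auto
  ultimately have "well_formed N' \<and> strict_path N' y w n \<and>
      (\<forall>u v. (u, None, v) \<in> edges N' \<longrightarrow> (u, None, v) \<in> edges N)"
    using establish_reuse.IH wf by blast
  moreover have "subnfa N N'"
    using establish_reuse.hyps by (auto dest: establish_subnfa)
  ultimately show ?case
    using establish_reuse.hyps(1) \<open>z \<in> nodes N\<close> by (auto simp: subnfa_def intro!: strict_path_snoc)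
next
  case (establish_fresh w z N ns)
  let ?N = "N\<lparr>nodes := insert z (nodes N)\<rparr>"
  have "\<forall>n\<in>set ns. \<not> is_final n \<and> n \<notin> nodes ?N"
    using establish_fresh by auto
  with establish_fresh well_formed_chain[of ns w ?N z]
  have "let N' = \<lparr>nodes = nodes ?N \<union> set ns, edges = edges ?N \<union> chain ns w z\<rparr> in
      well_formed N' \<and> strict_path N' (hd (ns @ [z])) w z"
    by (auto intro: well_formed_insert_node)
  moreover have "hd (ns @ [z]) = hd ns"
    using establish_fresh by (cases ns) auto
  ultimately show ?case
    using chain_no_eps by (simp add: Let_def chain_def)
qed

section \<open>Both invariants under an iteration step\<close>

lemma pop_sources_node:
  assumes "well_formed N" "Final q \<in> nodes N" "x \<in> pop_sources N q \<sigma>"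
  shows "x \<in> nodes N"
  using assms well_formedD(1)[OF assms(1)]
  by (auto simp: pop_sources_def pop_path_def split: if_splits)

text \<open>\<open>N\<^sub>0\<close> is the automaton in which the sources are determined,
  \<open>N\<close> the one with a path for \<open>rev \<tau>\<close> in place; they coincide for
  \<open>step_again\<close>. A new edge from \<open>x\<close> to \<open>y\<close> amounts to the run
  for the path from \<open>x\<close> to \<open>q\<close>, followed by one move of the
  transition.\<close>

lemma add_eps_edges_invariant:
  assumes wf0: "well_formed N\<^sub>0" and sound0: "sound N\<^sub>0 U\<^sub>0" and "U \<subseteq> U\<^sub>0"
    and sub: "subnfa N\<^sub>0 N" and wf: "well_formed N"
    and old: "\<And>u v. (u, None, v) \<in> edges N \<Longrightarrow> (u, None, v) \<in> edges N\<^sub>0"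
    and q: "Final q \<in> nodes N\<^sub>0" and \<theta>: "(q, \<sigma>, \<tau>, r) \<in> transitions P" "(q, \<sigma>, \<tau>, r) \<notin> U"
    and y: "strict_path N y (rev \<tau>) (Final r)"
  defines "N' \<equiv> add_eps_edges (pop_sources N\<^sub>0 q \<sigma>) y N"
  shows "well_formed N' \<and> sound N' U"
proof
  have sub': "subnfa N N'" "subnfa N\<^sub>0 N'"
    using sub subnfa_trans subnfa_add_eps_edges unfolding N'_def by blast+
  have edges: "edges N' = edges N \<union> {(x, None, y) | x. x \<in> pop_sources N\<^sub>0 q \<sigma>}"
    and nodes: "nodes N' = nodes N"
    by (auto simp: N'_def add_eps_edges_def)
  have S: "x \<in> nodes N\<^sub>0" if "x \<in> pop_sources N\<^sub>0 q \<sigma>" for x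
    using pop_sources_node[OF wf0 q that] .
  have "y \<in> nodes N"
    using y well_formedD(1)[OF wf] by (cases "rev \<tau>") (auto simp: strict_path_Cons)
  have "y \<noteq> M0"
    using strict_path_from_M0[OF wf, of "rev \<tau>" r] y transition_words[OF \<theta>(1)] by auto
  \<comment> \<open>An \<epsilon>-edge into \<open>q\<^sub>f\<close> can only come from a transition
    that pops \<open>b\<^sub>0\<close>, and edges labelled \<open>b\<^sub>0\<close> leave only
    \<open>M0\<close>.\<close>
  have "x = M0" if x: "x \<in> pop_sources N\<^sub>0 q \<sigma>" and "y = Final q\<^sub>f" for x
  proof -
    have "strict_path N y [] (Final q\<^sub>f)"
      using \<open>y = Final q\<^sub>f\<close> \<open>y \<in> nodes N\<close> by simp
    from strict_path_unique[OF wf y this] have "r = q\<^sub>f" by simp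
    with \<theta> accepting_transition have "\<sigma> = [b\<^sub>0]" by blast
    with x obtain z where "(x, Some b\<^sub>0, z) \<in> edges N\<^sub>0"
      by (auto simp: pop_sources_def pop_path_def)
    then show "x = M0" using well_formedD(2)[OF wf0] by blast
  qed
  note y_accepting = this
  have new: "(u, l, v) \<in> edges N \<or> u \<in> pop_sources N\<^sub>0 q \<sigma> \<and> l = None \<and> v = y"
    if "(u, l, v) \<in> edges N'" for u l v
    using that by (auto simp: edges)
  show "well_formed N'"
    unfolding well_formed_def
  proof (intro conjI allI ballI impI)
    fix u l v
    assume "(u, l, v) \<in> edges N'"
    from new[OF this] show "u \<in> nodes N'" "v \<in> nodes N'" "v \<noteq> M0"
      using well_formedD(1)[OF wf] S sub \<open>y \<in> nodes N\<close> \<open>y \<noteq> M0\<close>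
      unfolding nodes subnfa_def by blast+
  next
    fix u a v
    assume "(u, Some a, v) \<in> edges N'"
    with new have "(u, Some a, v) \<in> edges N" by blast
    from well_formedD(2)[OF wf this]
    show "\<not> is_final u" "a \<in> alphabet P" "v \<noteq> Final q\<^sub>f" "a = b\<^sub>0 \<Longrightarrow> u = M0"
      by auto
  next
    fix u
    assume "(u, None, Final q\<^sub>f) \<in> edges N'"
    with new well_formedD(3)[OF wf] y_accepting show "u = M0" by blast
  next
    fix u a v a' v'
    assume "(u, Some a, v) \<in> edges N'" "(u, Some a', v') \<in> edges N'"
    with new have "(u, Some a, v) \<in> edges N" "(u, Some a', v') \<in> edges N" by blast+
    from well_formedD(4)[OF wf this] show "a = a'" "v = v'" by auto
  next
    fix u
    assume "u \<in> nodes N'"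
    then show "\<exists>w q. strict_path N' u w (Final q)"
      using well_formedD(5)[OF wf] strict_path_mono[OF _ sub'(1)] unfolding nodes by blast
  next
    show "(M0, Some b\<^sub>0, Final (start P)) \<in> edges N'"
      using well_formedD(6)[OF wf] by (simp add: edges)
  qed
  have "\<exists>w p w' r. strict_path N' x w (Final p) \<and> strict_path N' v w' (Final r) \<and>
      (\<forall>\<rho> \<in> lists (alphabet P). \<exists>\<theta>s.
         run (remove_transitions U P) (p, rev w @ \<rho>) \<theta>s (r, rev w' @ \<rho>))"
    if e: "(x, None, v) \<in> edges N'" for x v
  proof (cases "(x, None, v) \<in> edges N\<^sub>0")
    case True
    then show ?thesis
      using sound_antimono[OF sound0 \<open>U \<subseteq> U\<^sub>0\<close>] strict_path_mono[OF _ sub'(2)]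
      unfolding sound_def by meson
  next
    case False
    with e old have x: "x \<in> pop_sources N\<^sub>0 q \<sigma>" and "v = y"
      unfolding edges by auto
    obtain w p where w: "strict_path N\<^sub>0 x w (Final p)"
      using well_formedD(5)[OF wf0] S[OF x] by blast
    obtain es where es: "path N\<^sub>0 x es (Final q)" "word es = rev \<sigma>"
      using pop_sources_path[OF x] S[OF x] by blast
    have "\<exists>\<theta>s. run (remove_transitions U P) (p, rev w @ \<rho>) \<theta>s (r, rev (rev \<tau>) @ \<rho>)"
      if \<rho>: "\<rho> \<in> lists (alphabet P)" for \<rho>
    proof -
      obtain \<theta>s where "run (remove_transitions U P) (p, rev w @ \<rho>) \<theta>s (q, \<sigma> @ \<rho>)"
        using path_imp_run[OF wf0 sound_antimono[OF sound0 \<open>U \<subseteq> U\<^sub>0\<close>] es(1) w \<rho>] es(2) by auto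
      moreover have "move (remove_transitions U P) (q, \<sigma>, \<tau>, r) (q, \<sigma> @ \<rho>) (r, \<tau> @ \<rho>)"
        using \<theta> \<rho> by (auto simp: remove_transitions_def intro: move.intros)
      ultimately show ?thesis
        using run_append run_Cons run_Nil by (metis rev_rev_ident)
    qed
    then show ?thesis
      using w y sub' strict_path_mono \<open>v = y\<close> by blast
  qed
  then show "sound N' U"
    unfolding sound_def by blast
qed

lemma forward_step_invariant:
  assumes "forward_step \<theta> (N, U) (N', U')" "\<theta> \<in> transitions P" "well_formed N" "sound N U"
  shows "well_formed N' \<and> sound N' U'"
  using assms(1)
proof cases
  case (step_first q \<sigma> \<tau> r N'' y)
  have "set (rev \<tau>) \<subseteq> alphabet P - {b\<^sub>0}" "Final r = Final q\<^sub>f \<Longrightarrow> rev \<tau> = []"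
    using step_first assms(2) transition_words accepting_transition by auto
  with establish_invariant[OF step_first(7) assms(3)]
  have *: "well_formed N''" "strict_path N'' y (rev \<tau>) (Final r)"
    "\<And>u v. (u, None, v) \<in> edges N'' \<Longrightarrow> (u, None, v) \<in> edges N"
    by auto
  show ?thesis
    unfolding step_first(2,3)
    by (rule add_eps_edges_invariant[OF assms(3,4) _ establish_subnfa[OF step_first(7)] *(1,3) _ _ _ *(2)])
      (use assms(2) step_first in auto)
next
  case (step_again q \<sigma> \<tau> r y)
  show ?thesis
    unfolding step_again(2,3)
    by (rule add_eps_edges_invariant[OF assms(3,4) _ subnfa_refl assms(3) _ _ _ _ step_again(7)])
      (use assms(2) step_again in auto)
qed (use assms in auto)

lemma forward_steps_invariant:
  "forward_steps \<theta>s s s' \<Longrightarrow> set \<theta>s \<subseteq> transitions P \<Longrightarrow>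
   well_formed (fst s) \<Longrightarrow> sound (fst s) (snd s) \<Longrightarrow>
   well_formed (fst s') \<and> sound (fst s') (snd s')"
proof (induction rule: forward_steps.induct)
  case (steps_Cons \<theta> s s' \<theta>s s'')
  then show ?case
    using forward_step_invariant[of \<theta> "fst s" "snd s" "fst s'" "snd s'"] by auto
qed simp

section \<open>Saturation\<close>

text \<open>The counterpart of \<open>sound\<close>, which lets a path follow the moves of a run; it
  is what the final pass, having changed nothing, guarantees.\<close>

definition saturated :: "('q, 'g) nfa \<Rightarrow> bool" where
  "saturated N \<longleftrightarrow>
     (\<forall>q \<sigma> \<tau> r x. (q, \<sigma>, \<tau>, r) \<in> transitions P \<longrightarrow> Final q \<in> nodes N \<longrightarrow>
        x \<in> pop_sources N q \<sigma> \<longrightarrow>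
        (\<exists>y. (x, None, y) \<in> edges N \<and> strict_path N y (rev \<tau>) (Final r)))"

text \<open>What the step adds is already present, as its result is the automaton it started
  from.\<close>

lemma stationary_step:
  assumes "forward_step (q, \<sigma>, \<tau>, r) (N, U) (N, U')" "(q, \<sigma>, \<tau>, r) \<in> transitions P"
    "well_formed N" "Final q \<in> nodes N" "x \<in> pop_sources N q \<sigma>"
  shows "\<exists>y. (x, None, y) \<in> edges N \<and> strict_path N y (rev \<tau>) (Final r)"
  using assms(1)
proof cases
  case (step_first N' y)
  have "set (rev \<tau>) \<subseteq> alphabet P - {b\<^sub>0}" "Final r = Final q\<^sub>f \<Longrightarrow> rev \<tau> = []"
    using assms(2) transition_words accepting_transition by auto
  with establish_invariant[OF step_first(6) assms(3)]
  have "strict_path N' y (rev \<tau>) (Final r)" by auto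
  moreover have "subnfa N' N"
    by (subst step_first(1)) (rule subnfa_add_eps_edges)
  moreover have "(x, None, y) \<in> edges N"
    by (subst step_first(1)) (use assms(5) in \<open>auto simp: add_eps_edges_def\<close>)
  ultimately show ?thesis using strict_path_mono by blast
next
  case (step_again y)
  have "(x, None, y) \<in> edges N"
    by (subst step_again(1)) (use assms(5) in \<open>auto simp: add_eps_edges_def\<close>)
  with step_again show ?thesis by blast
qed (use assms in auto)

lemma forward_loop_result:
  assumes "forward_loop P (N, U) (N', U')" "well_formed N" "sound N U"
  shows "well_formed N' \<and> sound N' U' \<and> saturated N'"
proof -
  have "well_formed (fst s') \<and> sound (fst s') (snd s') \<and> saturated (fst s')"
    if "forward_loop P s s'" "well_formed (fst s)" "sound (fst s) (snd s)" for s s'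
    using that
  proof (induction rule: forward_loop.induct)
    case (loop_stop N U U')
    then obtain \<theta>s where \<theta>s: "set \<theta>s = transitions P" "forward_steps \<theta>s (N, U) (N, U')"
      by (auto simp: forward_pass_def)
    \<comment> \<open>The last pass visits all transitions and leaves \<open>N\<close> unchanged, so
      each of them had a step that changed nothing.\<close>
    have "saturated N"
      unfolding saturated_def
    proof (intro allI impI)
      fix q \<sigma> \<tau> r x
      assume a: "(q, \<sigma>, \<tau>, r) \<in> transitions P" "Final q \<in> nodes N" "x \<in> pop_sources N q \<sigma>"
      with \<theta>s forward_steps_stationary[OF \<theta>s(2), of "(q, \<sigma>, \<tau>, r)"] obtain V V' where
        "forward_step (q, \<sigma>, \<tau>, r) (N, V) (N, V')" by auto
      from stationary_step[OF this a(1) _ a(2,3)] loop_stop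
      show "\<exists>y. (x, None, y) \<in> edges N \<and> strict_path N y (rev \<tau>) (Final r)" by simp
    qed
    with forward_steps_invariant[OF \<theta>s(2)] \<theta>s(1) loop_stop show ?case by simp
  next
    case (loop_again N U N' U' s)
    then obtain \<theta>s where \<theta>s: "set \<theta>s = transitions P" "forward_steps \<theta>s (N, U) (N', U')"
      by (auto simp: forward_pass_def)
    with forward_steps_invariant[OF \<theta>s(2)] loop_again show ?case by simp
  qed
  with assms show ?thesis by fastforce
qed

lemma forward_result:
  assumes "forward b\<^sub>0 P N U"
  shows "well_formed N \<and> sound N U \<and> saturated N"
proof -
  let ?N = "\<lparr>nodes = {M0, Final (start P)}, edges = {(M0, Some b\<^sub>0, Final (start P))}\<rparr>"
  have "strict_path ?N M0 [b\<^sub>0] (Final (start P))" "strict_path ?N (Final (start P)) [] (Final (start P))"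
    by (auto simp: strict_path_Cons)
  then have "\<forall>x \<in> nodes ?N. \<exists>w q. strict_path ?N x w (Final q)"
    unfolding nfa.select_convs by blast
  then have "well_formed ?N"
    using bottom_in_alphabet start_not_accepting unfolding well_formed_def by simp
  \<comment> \<open>There are no \<epsilon>-edges yet, so soundness holds although every transition
    is removed.\<close>
  moreover have "sound ?N (transitions P)"
    by (simp add: sound_def)
  ultimately show ?thesis
    using assms forward_loop_result unfolding forward_def by blast
qed

section \<open>Runs read as paths\<close>

lemma path_start:
  "well_formed N \<Longrightarrow> path N x es y \<Longrightarrow> x \<in> nodes N"
  using well_formedD(1) by (cases es) auto

lemma path_appendD:
  assumes "well_formed N"
  shows "path N x (es @ es') y \<Longrightarrow> \<exists>z. path N x es z \<and> path N z es' y"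
proof (induction es arbitrary: x)
  case Nil
  then show ?case using path_start[OF assms] by auto
next
  case (Cons e es)
  then show ?case by (cases e) auto
qed

text \<open>The cut is at the edge that contributes \<open>a\<close>; \<epsilon>-edges directly
  before it stay in \<open>es1\<close>. This matches \<open>pop_path\<close>, which starts with a
  labelled edge.\<close>

lemma word_eq_appendD: "word es = w @ a # w' \<Longrightarrow>
  \<exists>es1 u v es2. es = es1 @ (u, Some a, v) # es2 \<and> word es1 = w \<and> word es2 = w'"
proof (induction es arbitrary: w)
  case (Cons e es)
  obtain u l v where e: "e = (u, l, v)" by (cases e) auto
  show ?case
  proof (cases l)
    case None
    with Cons.prems e Cons.IH obtain es1 u' v' es2 where
      "es = es1 @ (u', Some a, v') # es2" "word es1 = w" "word es2 = w'" by auto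
    then show ?thesis
      using None e by (intro exI[of _ "e # es1"] exI[of _ u'] exI[of _ v'] exI[of _ es2]) auto
  next
    case (Some b)
    show ?thesis
    proof (cases w)
      case Nil
      with Cons.prems e Some show ?thesis
        by (intro exI[of _ "[]"] exI[of _ u] exI[of _ v] exI[of _ es]) auto
    next
      case (Cons c w'')
      with Cons.prems e Some have "word es = w'' @ a # w'" "b = c" by auto
      with Cons.IH obtain es1 u' v' es2 where
        "es = es1 @ (u', Some a, v') # es2" "word es1 = w''" "word es2 = w'" by blast
      then show ?thesis
        using Some e Cons \<open>b = c\<close>
        by (intro exI[of _ "e # es1"] exI[of _ u'] exI[of _ v'] exI[of _ es2]) auto
    qed
  qed
qed simp

text \<open>A path for the stack \<open>\<sigma> @ \<rho>\<close> reads \<open>rev \<rho>\<close>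
  before \<open>rev \<sigma>\<close>, and is cut at the edge for the last symbol of
  \<open>\<sigma>\<close>. For empty \<open>\<sigma>\<close> nothing is cut off and \<open>u\<close>
  is \<open>Final q\<close>.\<close>

lemma path_split_pop:
  assumes "well_formed N" "path N x es (Final q)" "word es = rev (\<sigma> @ \<rho>)"
  obtains es1 u es2 where "es = es1 @ es2" "path N x es1 u" "word es1 = rev \<rho>"
    "u \<in> pop_sources N q \<sigma>" "if \<sigma> = [] then es2 = [] else pop_path N u \<sigma> es2 q"
proof (cases \<sigma> rule: rev_cases)
  case Nil
  with assms that[of es "[]" "Final q"] show ?thesis
    by (simp add: pop_sources_def)
next
  case (snoc \<sigma>' a)
  with assms(3) have "word es = rev \<rho> @ a # rev \<sigma>'" by simp
  from word_eq_appendD[OF this] obtain es1 u v es2 where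
    es: "es = es1 @ (u, Some a, v) # es2" "word es1 = rev \<rho>" "word es2 = rev \<sigma>'"
    by blast
  with path_appendD[OF assms(1)] assms(2) obtain z where
    "path N x es1 z" "path N z ((u, Some a, v) # es2) (Final q)" by blast
  with es snoc have "path N x es1 u" "pop_path N u \<sigma> ((u, Some a, v) # es2) q"
    by (auto simp: pop_path_def eps_path_iff)
  with es snoc that[of es1 "(u, Some a, v) # es2" u] show ?thesis
    by (auto simp: pop_sources_def)
qed

text \<open>The tail that reads \<open>rev \<sigma>\<close> is replaced by an \<epsilon>-edge,
  supplied by saturation, and the strict path for \<open>rev \<tau>\<close>. The decomposition is
  exposed because the backward argument exploits the shared prefix \<open>es1\<close>.\<close>

lemma path_move:
  assumes wf: "well_formed N" and "saturated N"
    and "move (remove_transitions U P) (q, \<sigma>, \<tau>, r) c c'"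
    and "path N M0 es (Final (fst c))" "word es = rev (snd c)"
  obtains es1 u es2 y es3 where "es = es1 @ es2"
    "u \<in> pop_sources N q \<sigma>" "if \<sigma> = [] then es2 = [] else pop_path N u \<sigma> es2 q"
    "strict_path N y (rev \<tau>) (Final r)"
    "path N M0 (es1 @ (u, None, y) # es3) (Final (fst c'))"
    "word (es1 @ (u, None, y) # es3) = rev (snd c')"
proof -
  from assms(3) obtain \<rho> where \<theta>: "(q, \<sigma>, \<tau>, r) \<in> transitions P"
    and c: "c = (q, \<sigma> @ \<rho>)" "c' = (r, \<tau> @ \<rho>)"
    by (auto simp: remove_transitions_def elim: move.cases)
  from assms(4,5) c have "path N M0 es (Final q)" "word es = rev (\<sigma> @ \<rho>)" by simp_all
  then obtain es1 u es2 where
    es: "es = es1 @ es2" "path N M0 es1 u" "word es1 = rev \<rho>"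
      "u \<in> pop_sources N q \<sigma>" "if \<sigma> = [] then es2 = [] else pop_path N u \<sigma> es2 q"
    by (rule path_split_pop[OF wf])
  moreover have "Final q \<in> nodes N"
    using path_end[OF assms(4)] c by simp
  ultimately obtain y where y: "(u, None, y) \<in> edges N" "strict_path N y (rev \<tau>) (Final r)"
    using \<open>saturated N\<close> \<theta> unfolding saturated_def by blast
  from y(2) obtain es3 where es3: "path N y es3 (Final r)" "labels es3 = map Some (rev \<tau>)"
    by (auto simp: strict_path_def)
  from path_append[OF es(2), of "(u, None, y) # es3" "Final r"] es3(1) y(1)
  have "path N M0 (es1 @ (u, None, y) # es3) (Final r)" by simp
  moreover have "word (es1 @ (u, None, y) # es3) = rev (\<tau> @ \<rho>)"
    using word_strict[OF es3(2)] es(3) by simp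
  ultimately show ?thesis
    using that es y(2) c by simp
qed

text \<open>Only an \<epsilon>-edge from \<open>M0\<close> enters \<open>q\<^sub>f\<close>, and no
  edge enters \<open>M0\<close>.\<close>

lemma path_to_accepting:
  assumes wf: "well_formed N" and es: "path N M0 es (Final q\<^sub>f)"
  shows "es = [(M0, None, Final q\<^sub>f)]"
proof -
  have last_edge: "\<exists>u l. e = (u, l, y) \<and> (u, l, y) \<in> edges N \<and> path N M0 es' u"
    if "path N M0 (es' @ [e]) y" for es' e y
    using path_appendD[OF wf that] by (cases e) auto
  from es obtain es' e where es': "es = es' @ [e]"
    by (cases es rule: rev_cases) auto
  with es last_edge obtain u l where u: "e = (u, l, Final q\<^sub>f)" "(u, l, Final q\<^sub>f) \<in> edges N"
    "path N M0 es' u" by blast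
  have "l = None" using u(2) well_formedD(2)[OF wf] by (cases l) auto
  with u(2) well_formedD(3)[OF wf] have "u = M0" by simp
  have "es' = []"
  proof (cases es' rule: rev_cases)
    case (snoc es'' e')
    with u(3) last_edge \<open>u = M0\<close> well_formedD(1)[OF wf] show ?thesis by blast
  qed
  with es' u(1) \<open>l = None\<close> \<open>u = M0\<close> show ?thesis by simp
qed

text \<open>Iterates \<open>path_move\<close>. It shows that without a path to
  \<open>q\<^sub>f\<close> there is no accepting run.\<close>

lemma run_path_end:
  assumes "well_formed N" "saturated N"
  shows "run (remove_transitions U P) c \<theta>s c' \<Longrightarrow> path N M0 es (Final (fst c)) \<Longrightarrow>
    word es = rev (snd c) \<Longrightarrow> \<exists>es'. path N M0 es' (Final (fst c'))"
proof (induction arbitrary: es rule: run.induct)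
  case (run_Cons \<theta> c c' \<theta>s c'')
  obtain q \<sigma> \<tau> r where "\<theta> = (q, \<sigma>, \<tau>, r)" by (cases \<theta>)
  with run_Cons path_move[OF assms, of U q \<sigma> \<tau> r c c' es] show ?case by metis
qed blast

section \<open>The backward procedure\<close>

text \<open>The processed edges \<open>D\<close> and the found edges \<open>E\<close> are kept apart
  so that this can be a loop invariant; at the end it is used with \<open>E\<close> in both
  places.\<close>

definition closed_under ::
  "('q, 'g) pda \<Rightarrow> ('q, 'g) nfa \<Rightarrow> ('q, 'g) edge set \<Rightarrow> ('q, 'g) transition set \<Rightarrow>
   ('q, 'g) edge set \<Rightarrow> bool" where
  "closed_under P' N D U E \<longleftrightarrow>
     (\<forall>x y q \<sigma> \<tau> r. (x, None, y) \<in> D \<longrightarrow> strict_path N y (rev \<tau>) (Final r) \<longrightarrow>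
        (q, \<sigma>, \<tau>, r) \<in> transitions P' \<longrightarrow> x \<in> pop_sources N q \<sigma> \<longrightarrow>
        (q, \<sigma>, \<tau>, r) \<notin> U \<and>
        (\<forall>es u v. pop_path N x \<sigma> es q \<longrightarrow> (u, None, v) \<in> set es \<longrightarrow> (u, None, v) \<in> E))"

text \<open>The last path is the single edge from \<open>M0\<close> to \<open>q\<^sub>f\<close>,
  which is in \<open>E\<close>. Going back over a move, the prefix \<open>es1\<close> is common to
  both paths, and closure at the edge from \<open>u\<close> to \<open>y\<close> takes care of the
  transition and of the replaced tail \<open>es2\<close>.\<close>

lemma accepting_run_closed:
  assumes wf: "well_formed N" "saturated N"
    and closed: "closed_under (remove_transitions U\<^sub>1 P) N E U E"
    and "(M0, None, Final q\<^sub>f) \<in> E"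
  shows "run (remove_transitions U\<^sub>1 P) c \<theta>s c' \<Longrightarrow> fst c' = q\<^sub>f \<Longrightarrow>
    path N M0 es (Final (fst c)) \<Longrightarrow> word es = rev (snd c) \<Longrightarrow>
    (\<forall>u v. (u, None, v) \<in> set es \<longrightarrow> (u, None, v) \<in> E) \<and> set \<theta>s \<inter> U = {}"
proof (induction arbitrary: es rule: run.induct)
  case (run_Nil c)
  then have "es = [(M0, None, Final q\<^sub>f)]"
    using path_to_accepting[OF wf(1)] by simp
  with assms(4) show ?case by simp
next
  case (run_Cons \<theta> c c' \<theta>s c'')
  obtain q \<sigma> \<tau> r where \<theta>: "\<theta> = (q, \<sigma>, \<tau>, r)" by (cases \<theta>)
  with run_Cons.hyps(1) have trans: "(q, \<sigma>, \<tau>, r) \<in> transitions (remove_transitions U\<^sub>1 P)"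
    by (auto elim: move.cases)
  from run_Cons.hyps(1) run_Cons.prems(2,3) obtain es1 u es2 y es3 where
    es: "es = es1 @ es2" and u: "u \<in> pop_sources N q \<sigma>"
    and es2: "if \<sigma> = [] then es2 = [] else pop_path N u \<sigma> es2 q"
    and y: "strict_path N y (rev \<tau>) (Final r)"
    and new: "path N M0 (es1 @ (u, None, y) # es3) (Final (fst c'))"
      "word (es1 @ (u, None, y) # es3) = rev (snd c')"
    unfolding \<theta> by (rule path_move[OF wf])
  from run_Cons.IH[OF run_Cons.prems(1) new]
  have IH: "(u, None, y) \<in> E" "\<And>v w. (v, None, w) \<in> set es1 \<Longrightarrow> (v, None, w) \<in> E"
    "set \<theta>s \<inter> U = {}" by auto
  from closed IH(1) y trans u have "\<theta> \<notin> U"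
    and "\<And>es v w. pop_path N u \<sigma> es q \<Longrightarrow> (v, None, w) \<in> set es \<Longrightarrow> (v, None, w) \<in> E"
    unfolding closed_under_def \<theta> by blast+
  with IH es es2 show ?case by (auto split: if_splits)
qed

text \<open>An edge that accepting runs can use: \<open>rev (word es)\<close> is the stack below,
  over which the configuration of \<open>y\<close> leads to \<open>q\<^sub>f\<close>. In a
  well-formed automaton \<open>y\<close> determines \<open>\<tau>\<close> and \<open>r\<close>, so
  the universal quantifier speaks of one configuration.\<close>

definition productive :: "('q, 'g) pda \<Rightarrow> ('q, 'g) nfa \<Rightarrow> 'q nfa_state \<Rightarrow> 'q nfa_state \<Rightarrow> bool" where
  "productive P' N x y \<longleftrightarrow>
     (x, None, y) \<in> edges N \<and>
     (\<exists>es. path N M0 es x \<and>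
        (\<forall>\<tau> r. strict_path N y (rev \<tau>) (Final r) \<longrightarrow>
           (\<exists>\<theta>s \<gamma>. run P' (r, \<tau> @ rev (word es)) \<theta>s (q\<^sub>f, \<gamma>))))"

lemma productive_accepting:
  assumes wf: "well_formed N" and "(M0, None, Final q\<^sub>f) \<in> edges N"
  shows "productive P' N M0 (Final q\<^sub>f)"
proof -
  have nodes: "M0 \<in> nodes N" "Final q\<^sub>f \<in> nodes N"
    using well_formedD(1)[OF assms] by auto
  have "\<exists>\<theta>s \<gamma>. run P' (r, \<tau> @ rev (word [])) \<theta>s (q\<^sub>f, \<gamma>)"
    if "strict_path N (Final q\<^sub>f) (rev \<tau>) (Final r)" for \<tau> r
  proof -
    have "strict_path N (Final q\<^sub>f) [] (Final q\<^sub>f)"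
      using nodes by simp
    from strict_path_unique[OF wf that this] have "r = q\<^sub>f" by simp
    then show ?thesis using run_Nil by blast
  qed
  moreover have "path N M0 [] M0" using nodes by simp
  ultimately show ?thesis
    using assms(2) unfolding productive_def by blast
qed

text \<open>An accepting run is composed of the run for the path from \<open>M0\<close> to
  \<open>q\<close>, the transition itself, and the run that productivity of the edge from
  \<open>x\<close> to \<open>y\<close> provides. For an edge on the popping path, the rest of that
  path leads to the same configuration at \<open>q\<close>.\<close>

lemma productive_source:
  assumes "well_formed N" "sound N U\<^sub>1"
  defines "P' \<equiv> remove_transitions U\<^sub>1 P"
  assumes "productive P' N x y" "strict_path N y (rev \<tau>) (Final r)"
    and \<theta>: "(q, \<sigma>, \<tau>, r) \<in> transitions P'" and x: "x \<in> pop_sources N q \<sigma>"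
  shows "\<not> useless P' (q, \<sigma>, \<tau>, r)"
    and "pop_path N x \<sigma> es' q \<Longrightarrow> (u, None, v) \<in> set es' \<Longrightarrow> productive P' N u v"
proof -
  note wf = assms(1)
  obtain es where es: "path N M0 es x"
    and "\<exists>\<theta>s \<gamma>. run P' (r, \<tau> @ rev (word es)) \<theta>s (q\<^sub>f, \<gamma>)"
    using assms(4,5) unfolding productive_def by blast
  moreover have "rev (word es) \<in> lists (alphabet P)"
    using word_in_alphabet[OF wf es] by auto
  then have "move P' (q, \<sigma>, \<tau>, r) (q, \<sigma> @ rev (word es)) (r, \<tau> @ rev (word es))"
    using \<theta> by (auto simp: P'_def remove_transitions_def intro: move.intros)
  ultimately obtain \<theta>s \<gamma> where
    resume: "run P' (q, \<sigma> @ rev (word es)) ((q, \<sigma>, \<tau>, r) # \<theta>s) (q\<^sub>f, \<gamma>)"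
    by (blast intro: run_Cons)
  obtain es2 where es2: "path N x es2 (Final q)" "word es2 = rev \<sigma>"
    using pop_sources_path[OF x] path_end[OF es] by blast
  \<comment> \<open>This makes \<open>M0\<close> stand for the initial configuration, with nothing
    below.\<close>
  have "strict_path N M0 [b\<^sub>0] (Final (start P))"
    using well_formedD(6)[OF wf] well_formedD(1)[OF wf well_formedD(6)[OF wf]]
    by (auto simp: strict_path_Cons)
  from path_imp_run[OF assms(1,2) path_append[OF es es2(1)] this, of "[]"] es2(2)
  obtain \<theta>s' where "run P' (start P, [b\<^sub>0]) \<theta>s' (q, \<sigma> @ rev (word es))"
    by (auto simp: P'_def)
  from run_append[OF this resume]
  have "run P' (start P', start_stack P') (\<theta>s' @ (q, \<sigma>, \<tau>, r) # \<theta>s) (q\<^sub>f, \<gamma>)"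
    by (simp add: P'_def remove_transitions_def start_stack)
  moreover have "q\<^sub>f \<in> finals P'"
    by (simp add: P'_def remove_transitions_def finals)
  moreover have "(q, \<sigma>, \<tau>, r) \<in> set (\<theta>s' @ (q, \<sigma>, \<tau>, r) # \<theta>s)" by simp
  ultimately show "\<not> useless P' (q, \<sigma>, \<tau>, r)"
    unfolding useless_def by blast
  assume es': "pop_path N x \<sigma> es' q" and uv: "(u, None, v) \<in> set es'"
  from uv obtain esa esb where split: "es' = esa @ (u, None, v) # esb"
    by (auto simp: in_set_conv_decomp)
  from pop_path_imp_path[OF es'] have word: "word esa @ word esb = rev \<sigma>"
    and "path N x (esa @ (u, None, v) # esb) (Final q)"
    by (simp_all add: split)
  with path_appendD[OF wf] have esa: "path N x esa u" and edge: "(u, None, v) \<in> edges N"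
    and esb: "path N v esb (Final q)"
    by fastforce+
  have u: "path N M0 (es @ esa) u" using path_append[OF es esa] .
  have "\<exists>\<theta>s \<gamma>. run P' (r', \<tau>' @ rev (word (es @ esa))) \<theta>s (q\<^sub>f, \<gamma>)"
    if "strict_path N v (rev \<tau>') (Final r')" for \<tau>' r'
  proof -
    have "rev (word (es @ esa)) \<in> lists (alphabet P)"
      using word_in_alphabet[OF wf u] by auto
    from path_imp_run[OF assms(1,2) esb that this] obtain \<theta>s where
      "run P' (r', \<tau>' @ rev (word (es @ esa))) \<theta>s (q, rev (word esb) @ rev (word esa) @ rev (word es))"
      by (auto simp: P'_def)
    \<comment> \<open>The symbols read along \<open>esa\<close> and \<open>esb\<close> make up
      \<open>\<sigma>\<close>, so the stack at \<open>q\<close> is the one from which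
      \<open>resume\<close> starts.\<close>
    moreover have "rev (word esb) @ rev (word esa) = \<sigma>"
      using word by (metis rev_append rev_rev_ident)
    ultimately have "run P' (r', \<tau>' @ rev (word (es @ esa))) \<theta>s (q, \<sigma> @ rev (word es))"
      by (metis append_assoc)
    from run_append[OF this resume] show ?thesis by blast
  qed
  with u edge show "productive P' N u v"
    unfolding productive_def by blast
qed

text \<open>Usefulness of the deleted transitions gives one inclusion, closure the other.
  Productivity of the edges in \<open>E\<close> makes the former inductive.\<close>

definition backward_invariant ::
  "('q, 'g) pda \<Rightarrow> ('q, 'g) nfa \<Rightarrow>
   ('q, 'g) transition set \<times> ('q, 'g) edge set \<times> ('q, 'g) edge set \<Rightarrow> bool" where
  "backward_invariant P' N = (\<lambda>(U, E, D).
     U \<subseteq> transitions P' \<and> (\<forall>\<theta> \<in> transitions P' - U. \<not> useless P' \<theta>) \<and>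
     (M0, None, Final q\<^sub>f) \<in> E \<and> (\<forall>(x, l, y) \<in> E. l = None \<and> productive P' N x y) \<and>
     closed_under P' N D U E)"

lemma backward_step_invariant:
  assumes wf: "well_formed N" "sound N U\<^sub>1"
  defines "P' \<equiv> remove_transitions U\<^sub>1 P"
  assumes step: "backward_step P' N s s'" and inv: "backward_invariant P' N s"
  shows "backward_invariant P' N s'"
  using step
proof cases
  case (1 x y E D \<tau> r U)
  define U' where "U' = U - {(q, \<sigma>, \<tau>, r) | q \<sigma>. (q, \<sigma>, \<tau>, r) \<in> transitions P' \<and> x \<in> pop_sources N q \<sigma>}"
  define E' where "E' = E \<union> {(u, None, v) | u v q \<sigma> es.
      (q, \<sigma>, \<tau>, r) \<in> transitions P' \<and> x \<in> pop_sources N q \<sigma> \<and>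
      pop_path N x \<sigma> es q \<and> (u, None, v) \<in> set es}"
  have s: "s = (U, E, D)" "s' = (U', E', insert (x, None, y) D)"
    using 1 by (auto simp: U'_def E'_def)
  have prod: "productive P' N x y"
    using inv 1(3) by (auto simp: s backward_invariant_def)
  note source = productive_source[OF wf, folded P'_def, OF prod 1(4)]
  have "\<forall>\<theta> \<in> transitions P' - U'. \<not> useless P' \<theta>"
    using inv source(1) by (auto simp: s backward_invariant_def U'_def)
  moreover have "\<forall>(u, l, v) \<in> E'. l = None \<and> productive P' N u v"
    using inv source(2) by (auto simp: s backward_invariant_def E'_def)
  moreover have "closed_under P' N (insert (x, None, y) D) U' E'"
    unfolding closed_under_def
  proof (intro allI impI)
    fix x' y' q \<sigma> \<tau>' r'
    assume a: "(x', None, y') \<in> insert (x, None, y) D" "strict_path N y' (rev \<tau>') (Final r')"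
      "(q, \<sigma>, \<tau>', r') \<in> transitions P'" "x' \<in> pop_sources N q \<sigma>"
    show "(q, \<sigma>, \<tau>', r') \<notin> U' \<and>
      (\<forall>es u v. pop_path N x' \<sigma> es q \<longrightarrow> (u, None, v) \<in> set es \<longrightarrow> (u, None, v) \<in> E')"
    proof (cases "(x', None, y') \<in> D")
      \<comment> \<open>For an edge processed earlier the property persists, since \<open>U\<close>
        shrinks and \<open>E\<close> grows.\<close>
      case True
      with a inv show ?thesis
        by (auto simp: s backward_invariant_def closed_under_def U'_def E'_def)
    next
      case False
      with a have "x' = x" "y' = y" by auto
      \<comment> \<open>The step handles a single pair \<open>\<tau>\<close>, \<open>r\<close>;
        uniqueness of the strict path from \<open>y\<close> shows that there is no other.\<close>
      moreover from this a(2) strict_path_unique[OF wf(1) 1(4)] have "\<tau>' = \<tau>" "r' = r" by auto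
      ultimately show ?thesis
        using a unfolding U'_def E'_def by blast
    qed
  qed
  ultimately show ?thesis
    using inv by (auto simp: s backward_invariant_def U'_def E'_def)
qed

section \<open>The two inclusions for the returned set\<close>

theorem backward_correct:
  assumes "forward b\<^sub>0 P N U\<^sub>1"
  defines "P' \<equiv> remove_transitions U\<^sub>1 P"
  assumes result: "backward q\<^sub>f P' N U\<^sub>2"
  shows "U\<^sub>2 = {\<theta> \<in> transitions P'. useless P' \<theta>}"
proof -
  have wf: "well_formed N" "sound N U\<^sub>1" "saturated N"
    using forward_result[OF assms(1)] by auto
  have P': "start P' = start P" "start_stack P' = [b\<^sub>0]" "finals P' = {q\<^sub>f}"
    by (simp_all add: P'_def remove_transitions_def start_stack finals)
  have init: "path N M0 [(M0, Some b\<^sub>0, Final (start P))] (Final (fst (start P, [b\<^sub>0])))"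
    "word [(M0, Some b\<^sub>0, Final (start P))] = rev (snd (start P, [b\<^sub>0]))"
    using well_formedD(6)[OF wf(1)] well_formedD(1)[OF wf(1) well_formedD(6)[OF wf(1)]] by simp_all
  show ?thesis
  proof (cases "(M0, None, Final q\<^sub>f) \<in> edges N")
    case False
    \<comment> \<open>A run reaching \<open>q\<^sub>f\<close> would yield a path to
      \<open>q\<^sub>f\<close>, that is, the missing edge; so every transition is useless.\<close>
    have "\<not> run P' (start P, [b\<^sub>0]) \<theta>s (q\<^sub>f, \<gamma>)" for \<theta>s \<gamma>
    proof
      assume "run P' (start P, [b\<^sub>0]) \<theta>s (q\<^sub>f, \<gamma>)"
      then obtain es where "path N M0 es (Final q\<^sub>f)"
        using run_path_end[OF wf(1,3) _ init] unfolding P'_def by fastforce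
      with path_to_accepting[OF wf(1) this] False show False by simp
    qed
    then show ?thesis
      using result False by (auto simp: backward_def useless_def P')
  next
    case True
    let ?e = "(M0, None, Final q\<^sub>f) :: ('q, 'g) edge"
    from result True obtain E D where
      steps: "(backward_step P' N)\<^sup>*\<^sup>* (transitions P', {?e}, {}) (U\<^sub>2, E, D)" and "E \<subseteq> D"
      by (auto simp: backward_def)
    have "backward_invariant P' N (transitions P', {?e}, {})"
      using productive_accepting[OF wf(1) True]
      by (simp add: backward_invariant_def closed_under_def)
    with steps have inv: "backward_invariant P' N (U\<^sub>2, E, D)"
      by (induction rule: rtranclp_induct)
        (auto intro: backward_step_invariant[OF wf(1,2), folded P'_def])
    \<comment> \<open>As the loop stops with \<open>E \<subseteq> D\<close>, the processed edges may
      be replaced by all of \<open>E\<close>.\<close>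
    then have "closed_under P' N E U\<^sub>2 E" "?e \<in> E"
      using \<open>E \<subseteq> D\<close> unfolding backward_invariant_def closed_under_def by auto
    note accepting = accepting_run_closed[OF wf(1,3) this[unfolded P'_def], folded P'_def]
    have "useless P' \<theta>" if "\<theta> \<in> U\<^sub>2" for \<theta>
      unfolding useless_def P'
    proof safe
      fix \<theta>s \<gamma>
      assume "run P' (start P, [b\<^sub>0]) \<theta>s (q\<^sub>f, \<gamma>)" "\<theta> \<in> set \<theta>s"
      with accepting[OF _ _ init] that show False by fastforce
    qed
    with inv show ?thesis
      by (auto simp: backward_invariant_def)
  qed
qed

end

theorem theorem2:
  fixes P :: "('q, 'g) pda"
    and P\<^sub>0 P\<^sub>1 :: "('q extended, 'g marked) pda"
    and N :: "('q extended, 'g marked) nfa"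
    and U\<^sub>1 U\<^sub>2 :: "('q extended, 'g marked) transition set"
  assumes "is_pda P"
    and "P\<^sub>0 = with_bottom P"
    and "forward Bottom P\<^sub>0 N U\<^sub>1"
    and "P\<^sub>1 = remove_transitions U\<^sub>1 P\<^sub>0"
    and "backward Accepting P\<^sub>1 N U\<^sub>2"
  shows "U\<^sub>2 = {\<theta> \<in> transitions P\<^sub>1. useless P\<^sub>1 \<theta>}"
proof -
  have "set \<sigma> \<subseteq> alphabet P \<and> set \<tau> \<subseteq> alphabet P" if "(q, \<sigma>, \<tau>, r) \<in> transitions P" for q \<sigma> \<tau> r
    using that assms(1) by (auto simp: is_pda_def)
  \<comment> \<open>Stack symbols of \<open>P\<close> are wrapped in \<open>Sym\<close> and hence
    differ from \<open>Bottom\<close>; the only transition into \<open>Accepting\<close> is the one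
    that pops \<open>Bottom\<close>.\<close>
  then interpret marked_pda P\<^sub>0 Bottom Accepting
    unfolding assms(2) by unfold_locales (fastforce simp: with_bottom_def)+
  show ?thesis
    using backward_correct assms(3-5) by simp
qed

end
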